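(* Let $M>0$, $\mu\in(0,2]$. Fix an arbitrary sequence $\ell_1,\ldots,\ell_T$ of $\mu$-strongly convex differentiable losses on $[-\tfrac12M,\tfrac12M]$, expert predictions $y_t(i)\in[-\tfrac12M,\tfrac12M]$, $i\in\{1,\dots,K\}$, and corruptions $c_1,\ldots,c_T\in\mathbb R$. Let $\hat y_t$ be the predictions of Algorithm 1 (defined in the context) run with inputs $M$ and $\eta=\frac\mu8$, feedback $g_t=\ell_t'(\hat y_t)+c_t$, and $\kappa_t=1$ for all $t$, where $M\ge\max_t|\ell_t'(\hat y_t)+c_t|$. Provided that $\max_i\max_t|\hat y_t-y_t(i)|\le M$, for every expert $i^\star\in\{1,\dots,K\}$, $$\sum_{t=1}^T\Big(\ell_t(\hat y_t)-\ell_t\big(y_t(i^\star)\big)\Big)\le\frac{8M^2\log K}{\mu}+\sum_{t=1}^T\frac{c_t^2}{\mu}-\frac\mu8\sum_{t=1}^T\big(\hat y_t-y_t(i^\star)\big)^2 .$$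
   Context: A differentiable function $\ell$ is $\mu$-strongly convex on $[-\tfrac12M,\tfrac12M]$ if $\ell(y)-\ell(x)\le (y-x)\ell'(y)-\frac{\mu}{2}(x-y)^2$ for all $x,y$ in that interval. Algorithm 1 (prediction with expert advice, $K$ experts). Inputs $\eta\in(0,\tfrac12]$, $M>0$. Set $\gamma=\eta/M^2$ and $p_1(i)=1/K$ for all $i$. In each round $t=1,\ldots,T$: receive the expert predictions $y_t(1),\ldots,y_t(K)\in\mathbb{R}$; predict $\hat y_t=\sum_{i=1}^K p_t(i)y_t(i)$; receive feedback $g_t\in\mathbb{R}$ and $\kappa_t$; set $\tilde\ell_t(i)=\gamma(y_t(i)-\hat y_t)g_t+\kappa_{t-1}\big(\gamma(y_t(i)-\hat y_t)g_t\big)^2$ (with $\kappa_0=\kappa_1$); set $p_{t+1}(i)\propto\exp\!\big(-\kappa_t\sum_{s=1}^t\tilde\ell_s(i)\big)$, normalized to sum to one over $i$. Here $\log$ is the natural logarithm. *)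

theory Defs
  imports Complex_Main
begin

text \<open>The derivative is taken relative to \<open>S\<close>, hence one-sided at the end points of an interval, where
  \<open>l'\<close> is unique.\<close>

definition strongly_convex_on :: "real \<Rightarrow> real set \<Rightarrow> (real \<Rightarrow> real) \<Rightarrow> (real \<Rightarrow> real) \<Rightarrow> bool" where
  "strongly_convex_on \<mu> S l l' \<longleftrightarrow>
     (\<forall>x\<in>S. (l has_real_derivative l' x) (at x within S)) \<and>
     (\<forall>x\<in>S. \<forall>y\<in>S. l y - l x \<le> (y - x) * l' y - \<mu> / 2 * (x - y)\<^sup>2)"

text \<open>The prediction algorithm with experts \<open>{1..K}\<close>. Rounds are numbered from 1; values at round 0 are
  irrelevant. \<open>y t i\<close> is the prediction of expert \<open>i\<close> in round \<open>t\<close>, and \<open>g t\<close>, \<open>\<kappa> t\<close> are what the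
  algorithm receives in round \<open>t\<close> after predicting. \<open>predict t\<close> only depends on \<open>g s\<close>, \<open>\<kappa> s\<close> with
  \<open>s < t\<close>, so \<open>g t\<close> may be a function of \<open>predict t\<close>.\<close>

context
  fixes K :: nat and \<eta> M :: real
    and y :: "nat \<Rightarrow> nat \<Rightarrow> real" and g \<kappa> :: "nat \<Rightarrow> real"
begin

function weight :: "nat \<Rightarrow> nat \<Rightarrow> real"
  and predict :: "nat \<Rightarrow> real"
  and surrogate :: "nat \<Rightarrow> nat \<Rightarrow> real"
where
  "weight 0 i = 1 / real K"
| "weight (Suc 0) i = 1 / real K"
| "weight (Suc (Suc n)) i =
     exp (- \<kappa> (Suc n) * (\<Sum>s\<in>{1..Suc n}. surrogate s i)) /
     (\<Sum>j\<in>{1..K}. exp (- \<kappa> (Suc n) * (\<Sum>s\<in>{1..Suc n}. surrogate s j)))"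
| "predict t = (\<Sum>i\<in>{1..K}. weight t i * y t i)"
| "surrogate t i =
     (let \<gamma> = \<eta> / M\<^sup>2;
          \<kappa>prev = (if t \<le> 1 then \<kappa> 1 else \<kappa> (t - 1));
          v = \<gamma> * (y t i - predict t) * g t
      in v + \<kappa>prev * v\<^sup>2)"
  by pat_completeness auto
termination
  by (relation "measure (case_sum (\<lambda>(t, i). 3 * t) (case_sum (\<lambda>t. 3 * t + 1) (\<lambda>(t, i). 3 * t + 2)))") auto

end

end

theory Submission
  imports Defs
begin

text \<open>Write \<open>v t i = \<gamma> (y t i - yhat t) g t\<close>, so that \<open>\<bar>v t i\<bar> \<le> 1/2\<close> and the surrogate loss is \<open>v + v\<^sup>2\<close>.
  Since \<open>exp (- v - v\<^sup>2) \<le> 1 - v\<close> and \<open>yhat t\<close> is the weighted mean of the predictions, \<open>v t\<close> has weighted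
  mean 0 and the potential \<open>\<Sum>i. exp (- \<Sum>s\<le>t. (v s i + (v s i)\<^sup>2))\<close> never increases. This gives
  \<open>- \<Sum>t. (v t i + (v t i)\<^sup>2) \<le> ln K\<close>, a second-order bound on the linearized regret against expert \<open>i\<close>.
  Its quadratic term is at most \<open>\<mu>/8 (yhat t - y t i)\<^sup>2\<close> per round, and the corruption costs
  \<open>c\<^sup>2/\<mu> + \<mu>/4 (yhat t - y t i)\<^sup>2\<close> by AM-GM; strong convexity contributes \<open>- \<mu>/2 (yhat t - y t i)\<^sup>2\<close>.\<close>

text \<open>For \<open>v \<ge> 0\<close>, multiply by \<open>exp (v + v\<^sup>2)\<close> and replace
  that exponential by its quadratic Taylor polynomial, a lower bound. For \<open>v < 0\<close>,
  exponentiate \<open>x - x\<^sup>2 \<le> ln (1 + x)\<close> at \<open>x = - v\<close>.\<close>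

lemma exp_minus_minus_square_le:
  fixes v :: real
  assumes "\<bar>v\<bar> \<le> 1 / 2"
  shows "exp (- (v + v\<^sup>2)) \<le> 1 - v"
proof (cases "v \<ge> 0")
  case True
  have "1 \<le> (1 - v) * (1 + (v + v\<^sup>2) + (v + v\<^sup>2)\<^sup>2 / 2)"
  proof -
    \<comment> \<open>The product in the goal exceeds 1 by exactly
      \<open>v\<^sup>2 * ((1 + v) * (1 - v\<^sup>2) - 2 * v) / 2\<close>, so it suffices that the
      bracket is nonnegative; both halves of this chain use \<open>v \<le> 1 / 2\<close>.\<close>
    have "2 * v \<le> 1 * 1" using assms by simp
    also have "1 * 1 \<le> (1 + v) * (1 - v\<^sup>2)"
    proof -
      have sq: "v * v \<le> 1 / 2 * v"
        using True assms by (intro mult_right_mono) auto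
      have "v * (v * v) \<le> 1 / 2 * (1 / 2 * v)"
        using True assms by (intro mult_mono sq) auto
      with sq show ?thesis
        using True by (simp add: algebra_simps power2_eq_square)
    qed
    finally have "0 \<le> v\<^sup>2 * ((1 + v) * (1 - v\<^sup>2) - 2 * v) / 2" by simp
    also have "\<dots> = (1 - v) * (1 + (v + v\<^sup>2) + (v + v\<^sup>2)\<^sup>2 / 2) - 1"
      by (simp add: field_simps power2_eq_square)
    finally show ?thesis by simp
  qed
  also have "\<dots> \<le> (1 - v) * exp (v + v\<^sup>2)"
    using True assms by (intro mult_left_mono exp_lower_Taylor_quadratic) auto
  finally show ?thesis
    by (simp only: exp_minus) (simp add: field_simps)
next
  case False
  then have "- v - (- v)\<^sup>2 \<le> ln (1 + - v)"
    using assms by (intro ln_one_plus_pos_lower_bound) auto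
  then have "exp (- (v + v\<^sup>2)) \<le> exp (ln (1 - v))" by simp
  then show ?thesis using False by simp
qed

text \<open>The weights in \<open>mean\<close> are left unnormalised: a positive normaliser does not
  affect whether the mean vanishes, and in this form the linear term of the next round cancels
  directly.\<close>

lemma sum_exp_potential_le_card:
  fixes v :: "nat \<Rightarrow> 'a \<Rightarrow> real"
  assumes bound: "\<And>t i. t \<in> {1..T} \<Longrightarrow> i \<in> I \<Longrightarrow> \<bar>v t i\<bar> \<le> 1 / 2"
    and mean: "\<And>n. Suc n \<in> {1..T} \<Longrightarrow>
      (\<Sum>i\<in>I. exp (- (\<Sum>s\<in>{1..n}. v s i + (v s i)\<^sup>2)) * v (Suc n) i) = 0"
  shows "n \<le> T \<Longrightarrow> (\<Sum>i\<in>I. exp (- (\<Sum>s\<in>{1..n}. v s i + (v s i)\<^sup>2))) \<le> real (card I)"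
proof (induction n)
  case 0
  show ?case by simp
next
  case (Suc n)
  let ?E = "\<lambda>i. exp (- (\<Sum>s\<in>{1..n}. v s i + (v s i)\<^sup>2))"
  have "(\<Sum>i\<in>I. exp (- (\<Sum>s\<in>{1..Suc n}. v s i + (v s i)\<^sup>2)))
      = (\<Sum>i\<in>I. ?E i * exp (- (v (Suc n) i + (v (Suc n) i)\<^sup>2)))"
    by (intro sum.cong refl) (simp flip: exp_add)
  also have "\<dots> \<le> (\<Sum>i\<in>I. ?E i * (1 - v (Suc n) i))"
    using Suc.prems by (intro sum_mono mult_left_mono exp_minus_minus_square_le bound) auto
  also have "\<dots> = (\<Sum>i\<in>I. ?E i)"
    using mean[of n] Suc.prems by (simp add: right_diff_distrib sum_subtractf)
  also have "\<dots> \<le> real (card I)" using Suc by simp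
  finally show ?case .
qed

declare weight.simps [simp del] predict.simps [simp del] surrogate.simps [simp del]

text \<open>With \<kappa> constantly 1 the uniform first round is the case of an empty sum: every
  exponential is 1 and the normaliser is \<open>K\<close>.\<close>

lemma weight_Suc:
  "weight K \<eta> M y g (\<lambda>_. 1) (Suc n) i =
     exp (- (\<Sum>s\<in>{1..n}. surrogate K \<eta> M y g (\<lambda>_. 1) s i)) /
     (\<Sum>j\<in>{1..K}. exp (- (\<Sum>s\<in>{1..n}. surrogate K \<eta> M y g (\<lambda>_. 1) s j)))"
  by (cases n) (simp_all add: weight.simps)

lemma weight_Suc_nonneg: "0 \<le> weight K \<eta> M y g (\<lambda>_. 1) (Suc n) i"
  by (simp add: weight_Suc sum_nonneg)

lemma sum_weight_Suc:
  assumes "K > 0"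
  shows "(\<Sum>i\<in>{1..K}. weight K \<eta> M y g (\<lambda>_. 1) (Suc n) i) = 1"
proof -
  have "(\<Sum>j\<in>{1..K}. exp (- (\<Sum>s\<in>{1..n}. surrogate K \<eta> M y g (\<lambda>_. 1) s j))) > 0"
    using assms by (intro sum_pos) auto
  then show ?thesis by (simp add: weight_Suc flip: sum_divide_distrib)
qed

text \<open>A prediction is a convex combination of the experts' predictions. This lets strong
  convexity, assumed only on an interval, be applied at the prediction.\<close>

lemma predict_Suc_mem_atLeastAtMost:
  assumes "K > 0" and "\<And>i. i \<in> {1..K} \<Longrightarrow> y (Suc n) i \<in> {a..b}"
  shows "predict K \<eta> M y g (\<lambda>_. 1) (Suc n) \<in> {a..b}"
proof -
  let ?w = "weight K \<eta> M y g (\<lambda>_. 1) (Suc n)"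
  have "(\<Sum>i\<in>{1..K}. ?w i * a) \<le> (\<Sum>i\<in>{1..K}. ?w i * y (Suc n) i)"
    "(\<Sum>i\<in>{1..K}. ?w i * y (Suc n) i) \<le> (\<Sum>i\<in>{1..K}. ?w i * b)"
    using assms(2) by (intro sum_mono mult_left_mono weight_Suc_nonneg; force)+
  then show ?thesis
    using sum_weight_Suc[OF assms(1), of \<eta> M y g n]
    by (simp add: predict.simps flip: sum_distrib_right)
qed

lemma sum_exp_surrogate_mult_deviation_eq_0:
  assumes "K > 0"
  shows "(\<Sum>i\<in>{1..K}. exp (- (\<Sum>s\<in>{1..n}. surrogate K \<eta> M y g (\<lambda>_. 1) s i)) *
    (y (Suc n) i - predict K \<eta> M y g (\<lambda>_. 1) (Suc n))) = 0"
proof -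
  let ?E = "\<lambda>i. exp (- (\<Sum>s\<in>{1..n}. surrogate K \<eta> M y g (\<lambda>_. 1) s i))"
  let ?W = "\<Sum>i\<in>{1..K}. ?E i"
  let ?p = "predict K \<eta> M y g (\<lambda>_. 1) (Suc n)"
  have "?W > 0" using assms by (intro sum_pos) auto
  moreover have "?p = (\<Sum>i\<in>{1..K}. ?E i * y (Suc n) i) / ?W"
    by (simp add: predict.simps weight_Suc sum_divide_distrib)
  ultimately have "(\<Sum>i\<in>{1..K}. ?E i * y (Suc n) i) = ?W * ?p" by simp
  then show ?thesis by (simp add: right_diff_distrib sum_subtractf sum_distrib_right)
qed

lemma linearized_regret_le:
  fixes K T :: nat and \<eta> M :: real and y :: "nat \<Rightarrow> nat \<Rightarrow> real" and g yhat :: "nat \<Rightarrow> real"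
  assumes "M > 0" "0 < \<eta>" "\<eta> \<le> 1 / 2"
    and yhat: "\<And>t. t \<in> {1..T} \<Longrightarrow> yhat t = predict K \<eta> M y g (\<lambda>_. 1) t"
    and g: "\<And>t. t \<in> {1..T} \<Longrightarrow> \<bar>g t\<bar> \<le> M"
    and dev: "\<And>t i. t \<in> {1..T} \<Longrightarrow> i \<in> {1..K} \<Longrightarrow> \<bar>yhat t - y t i\<bar> \<le> M"
    and k: "k \<in> {1..K}"
  shows "(\<Sum>t\<in>{1..T}. (yhat t - y t k) * g t)
    \<le> M\<^sup>2 * ln (real K) / \<eta> + \<eta> * (\<Sum>t\<in>{1..T}. (yhat t - y t k)\<^sup>2)"
proof -
  have K: "K > 0" using k by auto
  define v where "v t i = \<eta> / M\<^sup>2 * (y t i - predict K \<eta> M y g (\<lambda>_. 1) t) * g t" for t i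
  have surr: "surrogate K \<eta> M y g (\<lambda>_. 1) t i = v t i + (v t i)\<^sup>2" for t i
    by (simp add: surrogate.simps v_def Let_def)
  have bound: "\<bar>v t i\<bar> \<le> 1 / 2" if "t \<in> {1..T}" "i \<in> {1..K}" for t i
  proof -
    have "\<bar>v t i\<bar> = \<eta> / M\<^sup>2 * (\<bar>yhat t - y t i\<bar> * \<bar>g t\<bar>)"
      using that assms(1,2) by (simp add: v_def yhat abs_mult abs_minus_commute)
    also have "\<dots> \<le> \<eta> / M\<^sup>2 * (M * M)"
      using that assms(1,2) g dev by (intro mult_left_mono mult_mono) auto
    also have "\<dots> = \<eta>" using assms(1) by (simp add: power2_eq_square)
    finally show ?thesis using assms(3) by simp
  qed
  have mean: "(\<Sum>i\<in>{1..K}. exp (- (\<Sum>s\<in>{1..n}. v s i + (v s i)\<^sup>2)) * v (Suc n) i) = 0" for n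
  proof -
    have "(\<Sum>i\<in>{1..K}. exp (- (\<Sum>s\<in>{1..n}. v s i + (v s i)\<^sup>2)) * v (Suc n) i) =
      \<eta> / M\<^sup>2 * g (Suc n) * (\<Sum>i\<in>{1..K}. exp (- (\<Sum>s\<in>{1..n}. v s i + (v s i)\<^sup>2)) *
        (y (Suc n) i - predict K \<eta> M y g (\<lambda>_. 1) (Suc n)))"
      \<comment> \<open>Only round \<open>Suc n\<close> is unfolded, so that \<open>v\<close> stays
        folded in the exponents.\<close>
      unfolding sum_distrib_left v_def[of "Suc n"] by (intro sum.cong) auto
    also have "\<dots> = 0"
      using sum_exp_surrogate_mult_deviation_eq_0[OF K, where n = n and \<eta> = \<eta> and M = M and y = y and g = g] by (simp only: surr mult_zero_right)
    finally show ?thesis .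
  qed
  have "exp (- (\<Sum>s\<in>{1..T}. v s k + (v s k)\<^sup>2))
      \<le> (\<Sum>i\<in>{1..K}. exp (- (\<Sum>s\<in>{1..T}. v s i + (v s i)\<^sup>2)))"
    using k by (intro member_le_sum) auto
  also have "\<dots> \<le> real (card {1..K})"
    by (rule sum_exp_potential_le_card[OF bound mean order_refl])
  finally have "- (\<Sum>t\<in>{1..T}. v t k + (v t k)\<^sup>2) \<le> ln (real K)"
    using K by (simp add: ln_ge_iff)
  \<comment> \<open>One factor \<open>\<eta> / M\<^sup>2\<close> is kept outside, to be divided out
    at the end; in the quadratic term the other one absorbs
    \<open>(g t)\<^sup>2 \<le> M\<^sup>2\<close> and leaves \<eta>.\<close>
  moreover have "\<eta> / M\<^sup>2 * ((yhat t - y t k) * g t - \<eta> * (yhat t - y t k)\<^sup>2) \<le> - (v t k + (v t k)\<^sup>2)"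
    if "t \<in> {1..T}" for t
  proof -
    have "(g t)\<^sup>2 \<le> M\<^sup>2" using g[OF that] by (simp add: abs_le_square_iff[symmetric])
    then have "(\<eta> / M\<^sup>2)\<^sup>2 * (yhat t - y t k)\<^sup>2 * (g t)\<^sup>2 \<le> (\<eta> / M\<^sup>2)\<^sup>2 * (yhat t - y t k)\<^sup>2 * M\<^sup>2"
      by (intro mult_left_mono) auto
    also have "\<dots> = \<eta> / M\<^sup>2 * (\<eta> * (yhat t - y t k)\<^sup>2)"
      using assms(1) by (simp add: field_simps power2_eq_square)
    finally have "(\<eta> / M\<^sup>2)\<^sup>2 * (yhat t - y t k)\<^sup>2 * (g t)\<^sup>2 \<le> \<eta> / M\<^sup>2 * (\<eta> * (yhat t - y t k)\<^sup>2)" .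
    moreover have "v t k = - (\<eta> / M\<^sup>2 * ((yhat t - y t k) * g t))"
      unfolding v_def yhat[OF that] by (simp add: left_diff_distrib right_diff_distrib diff_divide_distrib)
    ultimately show ?thesis
      by (simp only: power2_minus power_mult_distrib right_diff_distrib mult.assoc)
  qed
  then have "(\<Sum>t\<in>{1..T}. \<eta> / M\<^sup>2 * ((yhat t - y t k) * g t - \<eta> * (yhat t - y t k)\<^sup>2))
      \<le> (\<Sum>t\<in>{1..T}. - (v t k + (v t k)\<^sup>2))"
    by (rule sum_mono)
  ultimately have "\<eta> / M\<^sup>2 * ((\<Sum>t\<in>{1..T}. (yhat t - y t k) * g t) - \<eta> * (\<Sum>t\<in>{1..T}. (yhat t - y t k)\<^sup>2))
      \<le> ln (real K)"
    unfolding sum_negf by (simp only: sum_distrib_left[symmetric] sum_subtractf)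
  then show ?thesis
    using assms(1,2) by (simp add: field_simps)
qed

theorem theorem11:
  fixes M \<mu> :: real and K T :: nat
    and l l' :: "nat \<Rightarrow> real \<Rightarrow> real"
    and y :: "nat \<Rightarrow> nat \<Rightarrow> real"
    and c g yhat :: "nat \<Rightarrow> real"
    and i_star :: nat
  assumes "M > 0" and "0 < \<mu>" and "\<mu> \<le> 2"
    and "\<And>t. t \<in> {1..T} \<Longrightarrow> strongly_convex_on \<mu> {- M / 2..M / 2} (l t) (l' t)"
    and "\<And>t i. t \<in> {1..T} \<Longrightarrow> i \<in> {1..K} \<Longrightarrow> y t i \<in> {- M / 2..M / 2}"
    and "\<And>t. t \<in> {1..T} \<Longrightarrow> yhat t = predict K (\<mu> / 8) M y g (\<lambda>_. 1) t"
    and "\<And>t. t \<in> {1..T} \<Longrightarrow> g t = l' t (yhat t) + c t"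
    and "\<And>t. t \<in> {1..T} \<Longrightarrow> \<bar>l' t (yhat t) + c t\<bar> \<le> M"
    and "\<And>t i. t \<in> {1..T} \<Longrightarrow> i \<in> {1..K} \<Longrightarrow> \<bar>yhat t - y t i\<bar> \<le> M"
    and "i_star \<in> {1..K}"
  shows "(\<Sum>t\<in>{1..T}. l t (yhat t) - l t (y t i_star))
    \<le> 8 * M\<^sup>2 * ln (real K) / \<mu> + (\<Sum>t\<in>{1..T}. (c t)\<^sup>2 / \<mu>)
       - \<mu> / 8 * (\<Sum>t\<in>{1..T}. (yhat t - y t i_star)\<^sup>2)"
proof -
  have K: "K > 0" using assms(10) by auto
  let ?d = "\<lambda>t. yhat t - y t i_star"
  have step: "l t (yhat t) - l t (y t i_star) \<le> ?d t * g t + (c t)\<^sup>2 / \<mu> - \<mu> / 4 * (?d t)\<^sup>2"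
    if t: "t \<in> {1..T}" for t
  proof -
    obtain n where n: "t = Suc n" using t by (cases t) auto
    have "yhat t \<in> {- M / 2..M / 2}"
      using predict_Suc_mem_atLeastAtMost[OF K, of y n] assms(5,6)[OF t] unfolding n by metis
    moreover have "y t i_star \<in> {- M / 2..M / 2}" using assms(5)[OF t assms(10)] .
    \<comment> \<open>The derivative is taken at \<open>yhat t\<close>, where the feedback observes
      it up to \<open>c t\<close>.\<close>
    ultimately have "l t (yhat t) - l t (y t i_star)
        \<le> ?d t * l' t (yhat t) - \<mu> / 2 * (y t i_star - yhat t)\<^sup>2"
      using assms(4)[OF t] unfolding strongly_convex_on_def by blast
    also have "\<dots> = ?d t * g t - ?d t * c t - \<mu> / 2 * (?d t)\<^sup>2"
      using assms(7)[OF t] by (simp add: power2_commute algebra_simps)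
    finally have "l t (yhat t) - l t (y t i_star) \<le> ?d t * g t - ?d t * c t - \<mu> / 2 * (?d t)\<^sup>2" .
    \<comment> \<open>This square bounds \<open>- ?d t * c t\<close>; its weight \<mu>/2 is chosen
      so that half of the strong convexity term survives.\<close>
    moreover have "0 \<le> (c t + \<mu> / 2 * ?d t)\<^sup>2 / \<mu>" using assms(2) by simp
    moreover have "(c t + \<mu> / 2 * ?d t)\<^sup>2 / \<mu> = (c t)\<^sup>2 / \<mu> + ?d t * c t + \<mu> / 4 * (?d t)\<^sup>2"
      using assms(2) by (simp add: field_simps power2_eq_square)
    ultimately show ?thesis by linarith
  qed
  have "(\<Sum>t\<in>{1..T}. l t (yhat t) - l t (y t i_star))
      \<le> (\<Sum>t\<in>{1..T}. ?d t * g t + (c t)\<^sup>2 / \<mu> - \<mu> / 4 * (?d t)\<^sup>2)"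
    by (intro sum_mono step)
  also have "\<dots> = (\<Sum>t\<in>{1..T}. ?d t * g t) + (\<Sum>t\<in>{1..T}. (c t)\<^sup>2 / \<mu>)
      - \<mu> / 4 * (\<Sum>t\<in>{1..T}. (?d t)\<^sup>2)"
    by (simp add: sum.distrib sum_subtractf sum_distrib_left)
  \<comment> \<open>Here \<eta> = \<mu>/8 is at most 1/4 because \<mu> \<le> 2. The second-order
    term uses up half of the remaining \<mu>/4, which leaves the \<mu>/8 of the claim.\<close>
  also have "(\<Sum>t\<in>{1..T}. ?d t * g t)
      \<le> M\<^sup>2 * ln (real K) / (\<mu> / 8) + \<mu> / 8 * (\<Sum>t\<in>{1..T}. (?d t)\<^sup>2)"
    by (rule linearized_regret_le) (use assms in auto)
  finally show ?thesis by (simp add: algebra_simps)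
qed

end
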